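(* Let $V_c=\{1,\dots,n\}$, let $G_c=(V_c,A_c)$ be a conflict graph with finite arc weights $s_{h,k}\ge 0$, and let $d_h\in\mathbb{R}$ for $h\in V_c$. Then the problem $$(P^D_1)\qquad \min \sum_{h\in V_c}u_h\quad\text{s.t.}\quad u_h-u_k\le s_{h,k}\ \ ((h,k)\in A_c),\qquad u_h\ge d_h\ \ (h\in V_c)$$ is (in the sense specified in the context) the dual of the one-to-all shortest path problem from source vertex $0$ on the auxiliary weighted directed graph $\hat G_c=(\hat V_c,\hat A_c)$.
   Context: $V_c=\{1,\dots,n\}$ is a finite nonempty set (vehicles). The conflict graph $G_c=(V_c,A_c)$ is a finite directed graph, possibly cyclic and/or disconnected, whose arcs join distinct vertices; each arc $(h,k)\in A_c$ carries a finite weight $s_{h,k}\ge 0$. The numbers $d_h\in\mathbb{R}$ (observed deviations) may have any sign. The variables $u_h$ are real. Auxiliary graph: $\hat V_c=V_c\cup\{0\}$, $\hat A_c=A_c\cup\{(0,h): h\in V_c\}$, where arcs of $A_c$ keep their weights $s_{h,k}$ and the new arcs have weight $s_{0,h}=-d_h$ (no arc enters vertex $0$). The one-to-all shortest path problem from $0$ on a weighted digraph $(\{0\}\cup V_c,\hat A_c,s)$ is the linear program that sends one unit of flow from $0$ to each vertex of $V_c$ at minimum cost: minimize $\sum_{a\in\hat A_c}s_af_a$ subject to $\sum_{h:(h,k)\in\hat A_c}f_{h,k}-\sum_{\ell:(k,\ell)\in\hat A_c}f_{k,\ell}=1$ for every $k\in V_c$ and $f_a\ge 0$ for all $a\in \hat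 A_c$. Its linear programming dual is: maximize $\sum_{k\in V_c}\pi_k$ subject to $\pi_k-\pi_h\le s_{h,k}$ for all $(h,k)\in\hat A_c$, with $\pi_0=0$. "$(P^D_1)$ is the dual" means that it coincides with this dual program after the sign change $u_k=-\pi_k$ (so that maximizing $\sum_k\pi_k$ becomes minimizing $\sum_k u_k$). *)

theory Defs
  imports Complex_Main "HOL-Library.FuncSet"
begin

(* A vector of R^I is an extensional function on I, so that it has no coordinates outside I. *)
abbreviation vectors :: "'i set \<Rightarrow> ('i \<Rightarrow> real) set" where
  "vectors I \<equiv> I \<rightarrow>\<^sub>E UNIV"

datatype goal = Minimize | Maximize

record 'i program =
  goal :: goal
  feasible :: "('i \<Rightarrow> real) set"
  objective :: "('i \<Rightarrow> real) \<Rightarrow> real"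

(* Maximizing z is the same problem as minimizing -z, and conversely. *)
definition reverse_goal :: "'i program \<Rightarrow> 'i program" where
  "reverse_goal P =
     \<lparr>goal = (case goal P of Minimize \<Rightarrow> Maximize | Maximize \<Rightarrow> Minimize),
      feasible = feasible P,
      objective = (\<lambda>x. - objective P x)\<rparr>"

(* Q is P after the change of variables y = T x. *)
definition coincide_under ::
  "(('i \<Rightarrow> real) \<Rightarrow> ('j \<Rightarrow> real)) \<Rightarrow> 'i program \<Rightarrow> 'j program \<Rightarrow> bool" where
  "coincide_under T P Q \<longleftrightarrow>
     goal P = goal Q \<and>
     bij_betw T (feasible P) (feasible Q) \<and>
     (\<forall>x\<in>feasible P. objective Q (T x) = objective P x)"


(* Data of a linear program in standard form: minimize c x subject to M x = b, x >= 0. *)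
record ('i, 'j) standard_lp =
  vars :: "'i set"
  rows :: "'j set"
  cost :: "'i \<Rightarrow> real"
  coef :: "'j \<Rightarrow> 'i \<Rightarrow> real"
  rhs :: "'j \<Rightarrow> real"

definition lp_primal :: "('i, 'j) standard_lp \<Rightarrow> 'i program" where
  "lp_primal L =
     \<lparr>goal = Minimize,
      feasible = {x \<in> vectors (vars L).
        (\<forall>j\<in>rows L. (\<Sum>i\<in>vars L. coef L j i * x i) = rhs L j) \<and> (\<forall>i\<in>vars L. x i \<ge> 0)},
      objective = (\<lambda>x. \<Sum>i\<in>vars L. cost L i * x i)\<rparr>"

(* Maximize b y subject to (transpose M) y <= c, with y free in sign. *)
definition lp_dual :: "('i, 'j) standard_lp \<Rightarrow> 'j program" where
  "lp_dual L =
     \<lparr>goal = Maximize,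
      feasible = {y \<in> vectors (rows L).
        \<forall>i\<in>vars L. (\<Sum>j\<in>rows L. coef L j i * y j) \<le> cost L i},
      objective = (\<lambda>y. \<Sum>j\<in>rows L. rhs L j * y j)\<rparr>"


(* In the following, V is the vertex set without the source r, E the arc set on insert r V,
   and w the arc weight. *)

definition shortest_path_problem ::
  "'v set \<Rightarrow> ('v \<times> 'v) set \<Rightarrow> ('v \<times> 'v \<Rightarrow> real) \<Rightarrow> ('v \<times> 'v) program" where
  "shortest_path_problem V E w =
     \<lparr>goal = Minimize,
      feasible = {f \<in> vectors E.
        (\<forall>k\<in>V. (\<Sum>h | (h, k) \<in> E. f (h, k)) - (\<Sum>l | (k, l) \<in> E. f (k, l)) = 1) \<and>
        (\<forall>a\<in>E. f a \<ge> 0)},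
      objective = (\<lambda>f. \<Sum>a\<in>E. w a * f a)\<rparr>"

(* The coefficients form the vertex-arc incidence matrix without the row of the source. *)
definition shortest_path_lp ::
  "'v set \<Rightarrow> ('v \<times> 'v) set \<Rightarrow> ('v \<times> 'v \<Rightarrow> real) \<Rightarrow> ('v \<times> 'v, 'v) standard_lp" where
  "shortest_path_lp V E w =
     \<lparr>vars = E, rows = V, cost = w,
      coef = (\<lambda>k a. of_bool (snd a = k) - of_bool (fst a = k)),
      rhs = (\<lambda>k. 1)\<rparr>"

definition shortest_path_dual ::
  "'v \<Rightarrow> 'v set \<Rightarrow> ('v \<times> 'v) set \<Rightarrow> ('v \<times> 'v \<Rightarrow> real) \<Rightarrow> 'v program" where
  "shortest_path_dual r V E w =
     \<lparr>goal = Maximize,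
      feasible = {p \<in> vectors (insert r V).
        (\<forall>(h, k)\<in>E. p k - p h \<le> w (h, k)) \<and> p r = 0},
      objective = (\<lambda>p. \<Sum>k\<in>V. p k)\<rparr>"


definition aux_arcs :: "nat set \<Rightarrow> (nat \<times> nat) set \<Rightarrow> (nat \<times> nat) set" where
  "aux_arcs V A = A \<union> {(0, h) | h. h \<in> V}"

(* The first case applies exactly to the new arcs, because no arc of A contains the vertex 0. *)
definition aux_weight :: "(nat \<times> nat \<Rightarrow> real) \<Rightarrow> (nat \<Rightarrow> real) \<Rightarrow> nat \<times> nat \<Rightarrow> real" where
  "aux_weight s d = (\<lambda>(h, k). if h = 0 then - d k else s (h, k))"

definition P1D ::
  "nat set \<Rightarrow> (nat \<times> nat) set \<Rightarrow> (nat \<times> nat \<Rightarrow> real) \<Rightarrow> (nat \<Rightarrow> real) \<Rightarrow> nat program" where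
  "P1D V A s d =
     \<lparr>goal = Minimize,
      feasible = {u \<in> vectors V.
        (\<forall>(h, k)\<in>A. u h - u k \<le> s (h, k)) \<and> (\<forall>h\<in>V. u h \<ge> d h)},
      objective = (\<lambda>u. \<Sum>h\<in>V. u h)\<rparr>"

end

theory Submission
  imports Defs
begin

text \<open>
  In the dual of the flow program, an arc \<open>(h, k)\<close> yields \<open>p k - p h \<le> w (h, k)\<close>, where the missing
  row of the source is made up for by \<open>p 0 = 0\<close>. The arcs that leave \<open>0\<close> then read
  \<open>p k \<le> - d k\<close>, which becomes \<open>d k \<le> u k\<close> under \<open>u = - p\<close>.
\<close>

text \<open>An explicit inverse \<open>T'\<close> on the feasible sets replaces separate proofs of
  injectivity and surjectivity; each use only has to name it.\<close>

lemma coincide_underI: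
  assumes "goal P = goal Q"
    and "\<And>x. x \<in> feasible P \<Longrightarrow> T x \<in> feasible Q"
    and "\<And>y. y \<in> feasible Q \<Longrightarrow> T' y \<in> feasible P"
    and "\<And>x. x \<in> feasible P \<Longrightarrow> T' (T x) = x"
    and "\<And>y. y \<in> feasible Q \<Longrightarrow> T (T' y) = y"
    and "\<And>x. x \<in> feasible P \<Longrightarrow> objective Q (T x) = objective P x"
  shows "coincide_under T P Q"
proof -
  have "bij_betw T (feasible P) (feasible Q)"
    by (rule bij_betw_byWitness[where f' = T']) (use assms in auto)
  with assms show ?thesis
    by (simp add: coincide_under_def)
qed

text \<open>The entries +1 select the arcs entering \<open>k\<close> and the entries -1 those
  leaving it. A loop at \<open>k\<close> has entry 0, and on the right its two occurrences
  cancel.\<close>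

lemma sum_incidence_row:
  fixes f :: "'v \<times> 'v \<Rightarrow> real"
  assumes "finite E"
  shows "(\<Sum>a\<in>E. (of_bool (snd a = k) - of_bool (fst a = k)) * f a) =
    (\<Sum>h | (h, k) \<in> E. f (h, k)) - (\<Sum>l | (k, l) \<in> E. f (k, l))"
proof -
  have "(\<Sum>a\<in>E. of_bool (snd a = k) * f a) = (\<Sum>a | a \<in> E \<and> snd a = k. f a)"
    using assms by (intro sum.mono_neutral_cong_right) auto
  \<comment> \<open>An arc with head \<open>k\<close> is determined by its tail, so the sum can run
    over tails.\<close>
  also have "\<dots> = (\<Sum>h | (h, k) \<in> E. f (h, k))"
    by (rule sum.reindex_bij_witness[where i = "\<lambda>h. (h, k)" and j = fst]) auto
  finally have "in": "(\<Sum>a\<in>E. of_bool (snd a = k) * f a) = (\<Sum>h | (h, k) \<in> E. f (h, k))" .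
  have "(\<Sum>a\<in>E. of_bool (fst a = k) * f a) = (\<Sum>a | a \<in> E \<and> fst a = k. f a)"
    using assms by (intro sum.mono_neutral_cong_right) auto
  also have "\<dots> = (\<Sum>l | (k, l) \<in> E. f (k, l))"
    by (rule sum.reindex_bij_witness[where i = "\<lambda>l. (k, l)" and j = snd]) auto
  finally show ?thesis
    using "in" by (simp add: left_diff_distrib sum_subtractf)
qed

text \<open>An arc's column has at most two nonzero entries, one per endpoint. An endpoint without a
  row, such as the source, contributes 0.\<close>

lemma sum_incidence_column:
  fixes y :: "'v \<Rightarrow> real"
  assumes "finite V"
  shows "(\<Sum>j\<in>V. (of_bool (k = j) - of_bool (h = j)) * y j) =
    (if k \<in> V then y k else 0) - (if h \<in> V then y h else 0)"
  using assms
  by (simp add: left_diff_distrib sum_subtractf of_bool_def if_distrib[where f = "\<lambda>c. c * _"] cong: if_cong)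

text \<open>This ensures that \<open>lp_dual\<close> is applied to data that really encode the flow
  problem.\<close>

lemma lp_primal_shortest_path_lp:
  assumes "finite E"
  shows "lp_primal (shortest_path_lp V E w) = shortest_path_problem V E w"
  using sum_incidence_row[OF assms]
  by (simp add: lp_primal_def shortest_path_lp_def shortest_path_problem_def)

text \<open>The mechanical dual has no coordinate at \<open>r\<close>, while
  \<open>shortest_path_dual\<close> has one that is fixed to 0. Forgetting it by restriction to
  \<open>V\<close> therefore loses nothing.\<close>

lemma lp_dual_shortest_path_lp:
  assumes "finite V" and "r \<notin> V" and "E \<subseteq> insert r V \<times> insert r V"
  shows "coincide_under (\<lambda>p. \<lambda>k\<in>V. p k)
    (shortest_path_dual r V E w) (lp_dual (shortest_path_lp V E w))"
proof -
  \<comment> \<open>The default 0 is the potential of the source, so arcs at \<open>r\<close> and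
    arcs inside \<open>V\<close> obey the same formula.\<close>
  define ext :: "('a \<Rightarrow> real) \<Rightarrow> 'a \<Rightarrow> real"
    where "ext y = (\<lambda>k. if k \<in> V then y k else 0)" for y
  have feasible_lp: "feasible (lp_dual (shortest_path_lp V E w)) =
      {y \<in> vectors V. \<forall>(h, k)\<in>E. ext y k - ext y h \<le> w (h, k)}"
    by (auto simp: lp_dual_def shortest_path_lp_def sum_incidence_column[OF assms(1)] ext_def)
  have arc: "h \<in> insert r V" "k \<in> insert r V" if "(h, k) \<in> E" for h k
    using that assms(3) by auto
  show ?thesis
  proof (rule coincide_underI[where T' = "\<lambda>y. \<lambda>k\<in>insert r V. if k = r then 0 else y k"])
    fix p assume "p \<in> feasible (shortest_path_dual r V E w)"
    then have p: "p \<in> vectors (insert r V)" "\<And>h k. (h, k) \<in> E \<Longrightarrow> p k - p h \<le> w (h, k)" "p r = 0"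
      by (auto simp: shortest_path_dual_def)
    have "ext (restrict p V) k = p k" if "k \<in> insert r V" for k
      using that p(3) assms(2) by (auto simp: ext_def)
    then have "ext (restrict p V) k - ext (restrict p V) h \<le> w (h, k)" if "(h, k) \<in> E" for h k
      using p(2)[OF that] arc[OF that] by simp
    then show "restrict p V \<in> feasible (lp_dual (shortest_path_lp V E w))"
      by (auto simp: feasible_lp)
    show "(\<lambda>k\<in>insert r V. if k = r then 0 else restrict p V k) = p"
      using p(1,3) by (intro PiE_ext[OF _ p(1)]) auto
  next
    fix y assume y: "y \<in> feasible (lp_dual (shortest_path_lp V E w))"
    have "(\<lambda>k\<in>insert r V. if k = r then 0 else y k) k = ext y k" if "k \<in> insert r V" for k
      using that assms(2) by (auto simp: ext_def)
    moreover have "ext y r = 0"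
      using assms(2) by (simp add: ext_def)
    ultimately show "(\<lambda>k\<in>insert r V. if k = r then 0 else y k)
        \<in> feasible (shortest_path_dual r V E w)"
      \<comment> \<open>Without \<open>restrict_apply\<close> the restricted function stays folded,
        so that the equation with \<open>ext y\<close> can rewrite it.\<close>
      using y arc by (auto simp: feasible_lp shortest_path_dual_def simp del: restrict_apply)
    show "restrict (\<lambda>k\<in>insert r V. if k = r then 0 else y k) V = y"
      using y assms(2) by (intro PiE_ext[where k = V and s = "\<lambda>_. UNIV"]) (auto simp: feasible_lp)
  qed (simp_all add: lp_dual_def shortest_path_lp_def shortest_path_dual_def reverse_goal_def)
qed

text \<open>\<open>coincide_under\<close> demands equal goals and equal values, hence
  \<open>reverse_goal\<close>: maximizing the sum of \<open>p\<close> is minimizing the sum of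
  \<open>- p\<close>. The negation also swaps the two ends in each arc constraint.\<close>

lemma P1D_shortest_path_dual:
  assumes "0 \<notin> V" and "A \<subseteq> V \<times> V"
  shows "coincide_under (\<lambda>p. \<lambda>k\<in>V. - p k)
    (reverse_goal (shortest_path_dual 0 V (aux_arcs V A) (aux_weight s d))) (P1D V A s d)"
proof -
  have arc: "h \<in> V" "k \<in> V" if "(h, k) \<in> A" for h k
    using that assms(2) by auto
  have "(\<forall>(h, k)\<in>aux_arcs V A. p k - p h \<le> aux_weight s d (h, k)) \<longleftrightarrow>
      (\<forall>(h, k)\<in>A. p k - p h \<le> s (h, k)) \<and> (\<forall>k\<in>V. p k - p 0 \<le> - d k)" for p :: "nat \<Rightarrow> real"
  proof -
    \<comment> \<open>Since 0 is not in \<open>V\<close>, no arc of \<open>A\<close> falls under the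
      case \<open>h = 0\<close> of the weight.\<close>
    have "aux_weight s d (h, k) = s (h, k)" if "(h, k) \<in> A" for h k
      using that assms by (auto simp: aux_weight_def)
    moreover have "aux_weight s d (0, k) = - d k" for k
      by (simp add: aux_weight_def)
    ultimately show ?thesis
      by (auto simp: aux_arcs_def ball_Un case_prod_beta)
  qed
  then have feasible_dual:
    "feasible (reverse_goal (shortest_path_dual 0 V (aux_arcs V A) (aux_weight s d))) =
      {p \<in> vectors (insert 0 V).
        (\<forall>(h, k)\<in>A. p k - p h \<le> s (h, k)) \<and> (\<forall>k\<in>V. p k \<le> - d k) \<and> p 0 = 0}"
    by (auto simp: reverse_goal_def shortest_path_dual_def)
  show ?thesis
  \<comment> \<open>The inverse negates on \<open>V\<close> and restores the normalization
    \<open>p 0 = 0\<close>, which \<open>u\<close> does not record.\<close>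
  proof (rule coincide_underI[where T' = "\<lambda>u. \<lambda>k\<in>insert 0 V. if k = 0 then 0 else - u k"])
    fix p
    assume p: "p \<in> feasible (reverse_goal (shortest_path_dual 0 V (aux_arcs V A) (aux_weight s d)))"
    then show "(\<lambda>k\<in>V. - p k) \<in> feasible (P1D V A s d)"
      using arc by (auto simp: feasible_dual P1D_def split: prod.splits)
    show "(\<lambda>k\<in>insert 0 V. if k = 0 then 0 else - (\<lambda>k\<in>V. - p k) k) = p"
      using p by (intro PiE_ext[where k = "insert 0 V" and s = "\<lambda>_. UNIV"])
        (auto simp: feasible_dual)
  next
    fix u assume u: "u \<in> feasible (P1D V A s d)"
    have nz: "k \<noteq> 0" if "k \<in> V" for k
      using that assms(1) by (cases k) auto
    have eq: "(\<lambda>k\<in>insert 0 V. if k = 0 then 0 else - u k) k = - u k" if "k \<in> V" for k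
      using that nz[OF that] by simp
    have "u h - u k \<le> s (h, k)" if "(h, k) \<in> A" for h k
      using u that by (auto simp: P1D_def)
    moreover have "d k \<le> u k" if "k \<in> V" for k
      using u that by (auto simp: P1D_def)
    moreover have "(\<lambda>k\<in>insert 0 V. if k = 0 then 0 else - u k) 0 = 0"
      by simp
    ultimately show "(\<lambda>k\<in>insert 0 V. if k = 0 then 0 else - u k)
        \<in> feasible (reverse_goal (shortest_path_dual 0 V (aux_arcs V A) (aux_weight s d)))"
      using arc by (auto simp: feasible_dual eq simp del: restrict_apply)
    show "(\<lambda>k\<in>V. - (\<lambda>k\<in>insert 0 V. if k = 0 then 0 else - u k) k) = u"
      using u nz by (intro PiE_ext[where k = V and s = "\<lambda>_. UNIV"]) (auto simp: P1D_def)
  qed (simp_all add: reverse_goal_def shortest_path_dual_def P1D_def sum_negf)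
qed

theorem proposition2:
  fixes n :: nat and V :: "nat set" and A :: "(nat \<times> nat) set"
    and s :: "nat \<times> nat \<Rightarrow> real" and d :: "nat \<Rightarrow> real"
  assumes "n \<ge> 1" and "V = {1..n}"
    and "A \<subseteq> V \<times> V" and "\<forall>(h, k)\<in>A. h \<noteq> k"
    and "\<forall>a\<in>A. s a \<ge> 0"
  shows "lp_primal (shortest_path_lp V (aux_arcs V A) (aux_weight s d)) =
           shortest_path_problem V (aux_arcs V A) (aux_weight s d) \<and>
         coincide_under (\<lambda>p. \<lambda>k\<in>V. p k)
           (shortest_path_dual 0 V (aux_arcs V A) (aux_weight s d))
           (lp_dual (shortest_path_lp V (aux_arcs V A) (aux_weight s d))) \<and>
         coincide_under (\<lambda>p. \<lambda>k\<in>V. - p k)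
           (reverse_goal (shortest_path_dual 0 V (aux_arcs V A) (aux_weight s d)))
           (P1D V A s d)"
proof -
  have V: "finite V" "0 \<notin> V"
    using assms(2) by auto
  have E: "aux_arcs V A \<subseteq> insert 0 V \<times> insert 0 V"
    using assms(3) by (auto simp: aux_arcs_def)
  then have "finite (aux_arcs V A)"
    by (rule finite_subset) (simp add: V)
  with V E assms(3) show ?thesis
    by (simp add: lp_primal_shortest_path_lp lp_dual_shortest_path_lp P1D_shortest_path_dual)
qed

end
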